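(* Let $K$ be a field of characteristic $0$ and let $T\in\mathbb{P}$, $T\neq\underline{1}$. Then there is a unique planar power series $f\in K\{\{x\}\}$ such that $f^T=1+x$ and whose constant term is $f(0)=1$.
   Context: $\mathbb{P}$ is the set of isomorphism classes of finite planar reduced rooted trees: finite rooted trees in which the children of every vertex are linearly ordered and no vertex has exactly one child. The empty tree $\underline{1}$ is included in $\mathbb{P}$; $x$ also denotes the tree with a single vertex. $\deg(T)$ is the number of leaves of $T$. For $m\ge 2$ and nonempty $T_1,\dots,T_m$, the $m$-ary grafting $\cdot_m(T_1,\dots,T_m)=T_1\cdots T_m$ is the tree whose root has exactly $m$ children, which are, in order, the roots of $T_1,\dots,T_m$. Empty trees are omitted in graftings: if exactly $k$ of the $m$ trees are nonempty, the result is the $k$-ary grafting of these in order if $k\ge 2$, the single nonempty tree if $k=1$, and $\underline{1}$ if $k=0$. $K\{\{x\}\}$ is the set of all formal (possibly infinite) sums $\sum_{S\in\mathbb{P}}a_S x^S$ with $a_S\in K$, where $x^{\underline{1}}=1$ and $x^x=x$; the constant term $f(0)$ is $a_{\underline{1}}$. The operations $\cdot_m$ ($m\ge2$) are extended $K$-multilinearly to formal sums, $\cdot_m\big(\sum a^{(1)}_Sx^S,\dots,\sum a^{(m)}_Sx^S\big)=\sum_{S_1,\dots,S_m}a^{(1)}_{S_1}\cdots a^{(m)}_{S_m}\,x^{\cdot_m(S_1,\dots,S_m)}$ (well defined, since grafting adds degrees and there are finitely many trees of each degree). For $T\ne\underline{1}$ of degree $n$, $\cdot_T$ is the $n$-ary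 operation given by $\cdot_x(f)=f$ and, for $T=T_1\cdots T_m$ with $T_i$ nonempty of degree $n_i$, $\cdot_T(f_1,\dots,f_n)=\cdot_m(\cdot_{T_1}(f_1,\dots,f_{n_1}),\dots,\cdot_{T_m}(f_{n-n_m+1},\dots,f_n))$. The $T$-th power is $f^T=\cdot_T(f,\dots,f)$. *)

theory Defs
  imports Main
begin

text \<open>
  The nonempty planar reduced rooted trees. A \<^term>\<open>Branch\<close> vertex has the children
  listed by its three arguments in order, hence at least two of them.
\<close>

datatype rtree = Leaf | Branch rtree rtree "rtree list"

text \<open>The set of all planar reduced trees; \<^term>\<open>None\<close> is the empty tree.\<close>

type_synonym ptree = "rtree option"

primrec rdeg :: "rtree \<Rightarrow> nat" where
  "rdeg Leaf = 1"
| "rdeg (Branch t u vs) = sum_list (rdeg t # rdeg u # map rdeg vs)"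

text \<open>The grafting of a list of \<open>m \<ge> 2\<close> possibly empty trees.\<close>

definition graft :: "ptree list \<Rightarrow> ptree" where
  "graft Ts = (case map the (filter (\<lambda>T. T \<noteq> None) Ts) of
      [] \<Rightarrow> None
    | [t] \<Rightarrow> Some t
    | t # u # vs \<Rightarrow> Some (Branch t u vs))"

text \<open>A planar power series is the family of its coefficients.\<close>

type_synonym 'k pseries = "ptree \<Rightarrow> 'k"

definition pmonom :: "ptree \<Rightarrow> 'k::field pseries" where
  "pmonom T = (\<lambda>S. if S = T then 1 else 0)"

definition pone :: "'k::field pseries" where
  "pone = pmonom None"

definition pX :: "'k::field pseries" where
  "pX = pmonom (Some Leaf)"

definition padd :: "'k::field pseries \<Rightarrow> 'k pseries \<Rightarrow> 'k pseries" where
  "padd f g = (\<lambda>S. f S + g S)"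

definition const_term :: "'k::field pseries \<Rightarrow> 'k" where
  "const_term f = f None"

text \<open>
  The \<open>m\<close>-ary operation on a list of \<open>m\<close> series; the sum is over a finite set
  by lemma \<open>finite_graft_fibre\<close> below.
\<close>

definition pgraft :: "'k::field pseries list \<Rightarrow> 'k pseries" where
  "pgraft fs = (\<lambda>S. \<Sum>Ss | length Ss = length fs \<and> graft Ss = S.
      \<Prod>i<length fs. (fs ! i) (Ss ! i))"

text \<open>Cuts a list into consecutive blocks of the given lengths.\<close>

primrec blocks :: "nat list \<Rightarrow> 'a list \<Rightarrow> 'a list list" where
  "blocks [] xs = []"
| "blocks (n # ns) xs = take n xs # blocks ns (drop n xs)"

text \<open>The operation of a nonempty tree on a list of as many series as the tree has leaves.\<close>

primrec tree_op :: "rtree \<Rightarrow> 'k::field pseries list \<Rightarrow> 'k pseries" where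
  "tree_op Leaf fs = hd fs"
| "tree_op (Branch t u vs) fs =
     pgraft (map2 (\<lambda>op gs. op gs)
       (tree_op t # tree_op u # map tree_op vs)
       (blocks (rdeg t # rdeg u # map rdeg vs) fs))"

text \<open>The value at the empty tree follows the convention that \<open>x\<close> to the empty tree is \<open>1\<close>.\<close>

definition tree_power :: "'k::field pseries \<Rightarrow> ptree \<Rightarrow> 'k pseries" where
  "tree_power f T = (case T of None \<Rightarrow> pone | Some t \<Rightarrow> tree_op t (replicate (rdeg t) f))"

lemma finite_graft_fibre: "finite {Ss. length Ss = m \<and> graft Ss = S}"
proof -
  define A where "A = insert None (insert S (case S of Some (Branch t u vs) \<Rightarrow>
    Some ` set (t # u # vs) | _ \<Rightarrow> {}))"
  have "finite A"
    by (auto simp: A_def split: option.split rtree.split)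
  moreover have "set Ss \<subseteq> A" if "graft Ss = S" for Ss
  proof
    fix T assume T: "T \<in> set Ss"
    show "T \<in> A"
    proof (cases T)
      case (Some t)
      then have "t \<in> set (map the (filter (\<lambda>T. T \<noteq> None) Ss))"
        using T by force
      then show ?thesis
        using that Some unfolding graft_def A_def
        by (auto split: list.splits simp del: set_map set_filter)
    qed (simp add: A_def)
  qed
  ultimately show ?thesis
    by (intro finite_subset[OF _ finite_lists_length_eq[of A m]]) auto
qed

lemma pgraft_pmonom:
  "pgraft (map pmonom Ts) = (pmonom (graft Ts) :: 'k::field pseries)"
proof
  fix S
  let ?B = "{Ss. length Ss = length Ts \<and> graft Ss = S}"
  have *: "(\<Prod>i<length Ts. (map pmonom Ts ! i) (Ss ! i)) = (if Ss = Ts then 1 else 0 :: 'k)"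
    if "Ss \<in> ?B" for Ss
  proof (cases "Ss = Ts")
    case False
    then obtain i where "i < length Ts" "Ss ! i \<noteq> Ts ! i"
      using \<open>Ss \<in> ?B\<close> by (auto simp: list_eq_iff_nth_eq)
    then have "\<exists>i\<in>{..<length Ts}. (map pmonom Ts ! i) (Ss ! i) = (0::'k)"
      by (auto simp: pmonom_def)
    then show ?thesis using False by (simp add: prod_zero)
  qed (simp add: pmonom_def)
  have "pgraft (map pmonom Ts) S = (\<Sum>Ss\<in>?B. if Ss = Ts then 1 else 0 :: 'k)"
    unfolding pgraft_def length_map by (rule sum.cong) (use * in auto)
  also have "\<dots> = pmonom (graft Ts) S"
    using finite_graft_fibre[of "length Ts" S] by (auto simp: pmonom_def sum.delta)
  finally show "pgraft (map pmonom Ts) S = (pmonom (graft Ts) S :: 'k)" .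
qed

lemma blocks_replicate:
  "sum_list ns \<le> n \<Longrightarrow> blocks ns (replicate n x) = map (\<lambda>k. replicate k x) ns"
  by (induction ns arbitrary: n) (auto simp: min_def)

lemma tree_op_pX: "tree_op t (replicate (rdeg t) pX) = (pmonom (Some t) :: 'k::field pseries)"
proof (induction t)
  case Leaf
  show ?case by (simp add: pX_def)
next
  case (Branch t u vs)
  have "map2 (\<lambda>op gs. op gs) (map tree_op ws) (map (\<lambda>k. replicate k pX) (map rdeg ws))
      = (map pmonom (map Some ws) :: 'k pseries list)"
    if "\<forall>w\<in>set ws. tree_op w (replicate (rdeg w) pX) = (pmonom (Some w) :: 'k pseries)" for ws
    using that by (induction ws) auto
  from this[of "t # u # vs"] have
    "tree_op (Branch t u vs) (replicate (rdeg (Branch t u vs)) pX)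
      = (pgraft (map pmonom (map Some (t # u # vs))) :: 'k pseries)"
    using Branch blocks_replicate[of "map rdeg (t # u # vs)" "rdeg (Branch t u vs)"
        "pX :: 'k pseries"]
    by (simp del: blocks.simps)
  also have "\<dots> = pmonom (Some (Branch t u vs))"
    unfolding pgraft_pmonom by (simp add: graft_def filter_map o_def)
  finally show ?case .
qed

lemma tree_power_pX: "tree_power pX T = pmonom T"
  by (simp add: tree_power_def pone_def tree_op_pX split: option.split)

end

theory Submission
  imports Defs
begin

text \<open>
  If \<open>f\<close> has constant term \<open>1\<close> and \<open>t\<close> has \<open>d\<close> leaves, then the coefficient of \<open>f\<^sup>t\<close> at \<open>S\<close> is
  \<open>d\<close> times the coefficient of \<open>f\<close> at \<open>S\<close> plus a term depending only on coefficients of \<open>f\<close> of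
  smaller degree. As \<open>d\<close> is invertible, the coefficients of a \<open>t\<close>-th root are determined
  degree by degree.
\<close>

lemma rdeg_pos: "rdeg t > 0"
  by (induction t) auto

definition pdeg :: "ptree \<Rightarrow> nat" where
  "pdeg S = (case S of None \<Rightarrow> 0 | Some t \<Rightarrow> rdeg t)"

lemma pdeg_simps [simp]: "pdeg None = 0" "pdeg (Some t) = rdeg t"
  by (simp_all add: pdeg_def)

lemma pdeg_eq_0_iff [simp]: "pdeg S = 0 \<longleftrightarrow> S = None"
  using rdeg_pos by (cases S) auto

lemma pdeg_graft: "pdeg (graft Ss) = sum_list (map pdeg Ss)"
proof -
  define ts where "ts = map the (filter (\<lambda>T. T \<noteq> None) Ss)"
  have "sum_list (map pdeg Ss) = sum_list (map rdeg ts)"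
    unfolding ts_def by (induction Ss) auto
  moreover have "pdeg (graft Ss) = sum_list (map rdeg ts)"
    unfolding graft_def ts_def[symmetric] by (auto split: list.split)
  ultimately show ?thesis by simp
qed

abbreviation single :: "nat \<Rightarrow> nat \<Rightarrow> ptree \<Rightarrow> ptree list" where
  "single m i S \<equiv> (replicate m None)[i := S]"

lemma graft_single: "i < m \<Longrightarrow> graft (single m i S) = S"
  by (cases S) (auto simp: upd_conv_take_nth_drop graft_def)

text \<open>Degrees add up under grafting, so an entry of degree at least \<open>pdeg S\<close>
  forces all other entries to have degree 0, that is, to be empty. The first case will give the
  linear terms of a power, the second the terms of lower degree.\<close>

lemma graft_eq_cases:
  assumes "graft Ss = S" "S \<noteq> None"
  obtains i where "i < length Ss" "Ss = single (length Ss) i S"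
  | "\<And>T. T \<in> set Ss \<Longrightarrow> pdeg T < pdeg S"
proof (cases "\<forall>T\<in>set Ss. pdeg T < pdeg S")
  case False
  then obtain i where i: "i < length Ss" "pdeg S \<le> pdeg (Ss ! i)"
    by (auto simp: in_set_conv_nth not_less)
  have "pdeg S = (\<Sum>j<length Ss. pdeg (Ss ! j))"
    using pdeg_graft[of Ss] assms(1) by (simp add: sum_list_sum_nth atLeast0LessThan)
  also have "\<dots> = pdeg (Ss ! i) + (\<Sum>j\<in>{..<length Ss} - {i}. pdeg (Ss ! j))"
    using i(1) by (intro sum.remove) auto
  finally have "(\<Sum>j\<in>{..<length Ss} - {i}. pdeg (Ss ! j)) = 0"
    using i(2) by simp
  then have "Ss = single (length Ss) i (Ss ! i)"
    using i(1) by (intro nth_equalityI) (auto simp: nth_list_update)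
  moreover from this have "Ss ! i = S"
    using graft_single[OF i(1), of "Ss ! i"] assms(1) by simp
  ultimately show ?thesis using that(1) i(1) by simp
qed (use that(2) in blast)

lemma graft_eq_None_iff: "graft Ss = None \<longleftrightarrow> Ss = replicate (length Ss) None"
proof -
  have "graft Ss = None \<longleftrightarrow> pdeg (graft Ss) = 0" by simp
  also have "\<dots> \<longleftrightarrow> (\<forall>T\<in>set Ss. T = None)"
    unfolding pdeg_graft by auto
  also have "\<dots> \<longleftrightarrow> Ss = replicate (length Ss) None"
    by (metis in_set_replicate replicate_eqI)
  finally show ?thesis .
qed

lemma pgraft_None: "pgraft fs None = (\<Prod>i<length fs. (fs ! i) None)"
proof -
  have "{Ss. length Ss = length fs \<and> graft Ss = None} = {replicate (length fs) None}"
    by (auto simp: graft_eq_None_iff)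
  then show ?thesis by (simp add: pgraft_def)
qed

lemma prod_single:
  fixes fs :: "'k::field pseries list"
  assumes "i < length fs" "\<And>f. f \<in> set fs \<Longrightarrow> f None = 1"
  shows "(\<Prod>j<length fs. (fs ! j) (single (length fs) i S ! j)) = (fs ! i) S"
proof -
  have "(\<Prod>j<length fs. (fs ! j) (single (length fs) i S ! j))
      = (\<Prod>j<length fs. if j = i then (fs ! j) S else 1)"
    using assms by (intro prod.cong) auto
  then show ?thesis using assms(1) by (simp add: prod.delta)
qed

text \<open>Linearisation of grafting at series with constant term 1. Lists in the fibre of
  \<open>S\<close> whose entries all have smaller degree contribute equally on both sides. A list
  \<open>single m i S\<close> contributes just the coefficient of the \<open>i\<close>-th series at
  \<open>S\<close>, its other factors being constant terms.\<close>

lemma pgraft_diff: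
  fixes fs gs :: "'k::field pseries list"
  assumes len: "length gs = length fs"
    and f1: "\<And>f. f \<in> set fs \<Longrightarrow> f None = 1"
    and g1: "\<And>g. g \<in> set gs \<Longrightarrow> g None = 1"
    and agree: "\<And>i S'. i < length fs \<Longrightarrow> pdeg S' < pdeg S \<Longrightarrow> (fs ! i) S' = (gs ! i) S'"
  shows "pgraft fs S - pgraft gs S = (\<Sum>i<length fs. (fs ! i) S - (gs ! i) S)"
proof (cases "S = None")
  case True
  have "(fs ! i) None = 1" "(gs ! i) None = 1" if "i < length fs" for i
    using that len f1 g1 by simp_all
  then show ?thesis using True len by (simp add: pgraft_None)
next
  case False
  let ?m = "length fs"
  let ?B = "{Ss. length Ss = ?m \<and> graft Ss = S}"
  \<comment> \<open>Written as a sum of indicators over positions, the difference covers both kinds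
    of lists at once, and the two sums can be swapped afterwards.\<close>
  have term_diff: "(\<Prod>j<?m. (fs ! j) (Ss ! j)) - (\<Prod>j<?m. (gs ! j) (Ss ! j))
      = (\<Sum>i<?m. if Ss = single ?m i S then (fs ! i) S - (gs ! i) S else 0)"
    if "Ss \<in> ?B" for Ss
  proof -
    from that have Ss: "length Ss = ?m" "graft Ss = S" by auto
    from Ss(2) False show ?thesis
    proof (cases rule: graft_eq_cases)
      case (1 i)
      then have i: "i < ?m" "Ss = single ?m i S" using Ss(1) by auto
      \<comment> \<open>As \<open>S\<close> is nonempty, its position can be read off the list, so
        exactly one indicator survives.\<close>
      have "single ?m i S = single ?m j S \<longleftrightarrow> i = j" if "j < ?m" for j
        using that i(1) False by (metis length_replicate nth_list_update nth_replicate)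
      then have "(\<Sum>j<?m. if Ss = single ?m j S then (fs ! j) S - (gs ! j) S else 0)
          = (\<Sum>j<?m. if i = j then (fs ! j) S - (gs ! j) S else 0)"
        using i(2) by (intro sum.cong) auto
      also have "\<dots> = (fs ! i) S - (gs ! i) S" using i(1) by simp
      finally show ?thesis
        using prod_single[of i fs S] prod_single[of i gs S] i len f1 g1 by simp
    next
      case 2
      have "Ss \<noteq> single ?m i S" if "i < ?m" for i
        using 2[of S] that set_update_memI[of i "replicate ?m None" S] by auto
      moreover have "(\<Prod>j<?m. (fs ! j) (Ss ! j)) = (\<Prod>j<?m. (gs ! j) (Ss ! j))"
        using 2 agree Ss(1) by (intro prod.cong) auto
      ultimately show ?thesis by simp
    qed
  qed
  have "pgraft fs S - pgraft gs S
      = (\<Sum>Ss\<in>?B. (\<Prod>j<?m. (fs ! j) (Ss ! j)) - (\<Prod>j<?m. (gs ! j) (Ss ! j)))"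
    by (simp add: pgraft_def len sum_subtractf)
  also have "\<dots> = (\<Sum>Ss\<in>?B. \<Sum>i<?m. if Ss = single ?m i S then (fs ! i) S - (gs ! i) S else 0)"
    using term_diff by (intro sum.cong) auto
  also have "\<dots> = (\<Sum>i<?m. \<Sum>Ss\<in>?B. if Ss = single ?m i S then (fs ! i) S - (gs ! i) S else 0)"
    by (rule sum.swap)
  also have "\<dots> = (\<Sum>i<?m. (fs ! i) S - (gs ! i) S)"
    using finite_graft_fibre[of ?m S] by (intro sum.cong) (auto simp: sum.delta graft_single)
  finally show ?thesis .
qed

lemma tree_power_Leaf: "tree_power f (Some Leaf) = f"
  by (simp add: tree_power_def)

text \<open>Blocks of a constant list are constant, so a power satisfies a recursion over the
  children. The inductions below use this in place of \<open>tree_op\<close>.\<close>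

lemma tree_power_Branch:
  "tree_power f (Some (Branch t u vs)) = pgraft (map (\<lambda>w. tree_power f (Some w)) (t # u # vs))"
proof -
  have "map2 (\<lambda>op gs. op gs) (map tree_op ws) (map (\<lambda>k. replicate k f) (map rdeg ws))
      = map (\<lambda>w. tree_power f (Some w)) ws" for ws
    by (induction ws) (auto simp: tree_power_def)
  from this[of "t # u # vs"] show ?thesis
    using blocks_replicate[of "map rdeg (t # u # vs)" "rdeg (Branch t u vs)" f]
    by (simp add: tree_power_def del: blocks.simps)
qed

lemma tree_power_None:
  assumes "f None = 1"
  shows "tree_power f (Some t) None = 1"
proof (induction t)
  case Leaf
  show ?case using assms by (simp add: tree_power_Leaf)
next
  case (Branch t u vs)
  let ?fs = "map (\<lambda>w. tree_power f (Some w)) (t # u # vs)"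
  have "h None = 1" if "h \<in> set ?fs" for h
    using that Branch by auto
  then have "(?fs ! i) None = 1" if "i < length ?fs" for i
    using that nth_mem by blast
  then show ?case
    unfolding tree_power_Branch pgraft_None by (intro prod.neutral) blast
qed

text \<open>Comparing two series that agree below \<open>S\<close> cancels the terms of lower
  degree, which therefore never need a formula. The factor arises because the leaf counts of the
  children add up.\<close>

lemma tree_power_diff:
  fixes f g :: "'k::field pseries"
  assumes "f None = 1" "g None = 1" "\<And>S'. pdeg S' < pdeg S \<Longrightarrow> f S' = g S'"
  shows "tree_power f (Some t) S - tree_power g (Some t) S = of_nat (rdeg t) * (f S - g S)"
  using assms(3)
proof (induction t arbitrary: S)
  case Leaf
  show ?case by (simp add: tree_power_Leaf)
next
  case (Branch t u vs)
  let ?ws = "t # u # vs"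
  let ?F = "\<lambda>w. tree_power f (Some w)" and ?G = "\<lambda>w. tree_power g (Some w)"
  \<comment> \<open>Needed in smaller degrees, to see that the powers of the children agree there,
    and at \<open>S\<close> itself, for the linear terms.\<close>
  have IH: "?F w S' - ?G w S' = of_nat (rdeg w) * (f S' - g S')"
    if "w \<in> set ?ws" "pdeg S' \<le> pdeg S" for w S'
  proof -
    have "f S'' = g S''" if "pdeg S'' < pdeg S'" for S''
      using Branch.prems that \<open>pdeg S' \<le> pdeg S\<close> by simp
    then show ?thesis using that(1) Branch.IH by auto
  qed
  have "pgraft (map ?F ?ws) S - pgraft (map ?G ?ws) S
      = (\<Sum>i<length (map ?F ?ws). (map ?F ?ws ! i) S - (map ?G ?ws ! i) S)"
  proof (rule pgraft_diff)
    fix i S' assume i: "i < length (map ?F ?ws)" and S': "pdeg S' < pdeg S"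
    then have "?ws ! i \<in> set ?ws" by (intro nth_mem) simp
    then have "?F (?ws ! i) S' = ?G (?ws ! i) S'"
      using IH[of "?ws ! i" S'] S' Branch.prems[OF S'] by simp
    then show "(map ?F ?ws ! i) S' = (map ?G ?ws ! i) S'"
      using i by (simp only: nth_map length_map)
  qed (use assms tree_power_None in auto)
  also have "\<dots> = (\<Sum>i<length ?ws. ?F (?ws ! i) S - ?G (?ws ! i) S)"
    by (intro sum.cong) (simp_all only: nth_map length_map lessThan_iff)
  also have "\<dots> = (\<Sum>i<length ?ws. of_nat (rdeg (?ws ! i)) * (f S - g S))"
    by (intro sum.cong refl IH nth_mem) auto
  also have "\<dots> = of_nat (sum_list (map rdeg ?ws)) * (f S - g S)"
  proof -
    have "sum_list (map rdeg ?ws) = (\<Sum>i<length ?ws. rdeg (?ws ! i))"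
      unfolding sum_list_sum_nth length_map atLeast0LessThan
      by (intro sum.cong refl nth_map) simp
    then show ?thesis by (simp only: of_nat_sum sum_distrib_right)
  qed
  finally show ?case by (simp add: tree_power_Branch)
qed

lemma tree_root_unique:
  fixes f g :: "'k::field_char_0 pseries"
  assumes "tree_power f (Some t) = tree_power g (Some t)" "f None = 1" "g None = 1"
  shows "f = g"
proof
  fix S show "f S = g S"
  proof (induction S rule: measure_induct_rule[where f = pdeg])
    case (less S)
    then show ?case
      using tree_power_diff[of f g S t] assms rdeg_pos[of t] by simp
  qed
qed

lemma tree_root_exists:
  fixes h :: "'k::field_char_0 pseries"
  assumes "h None = 1"
  shows "\<exists>f. tree_power f (Some t) = h \<and> f None = 1"
proof -
  let ?P = "\<lambda>f. tree_power f (Some t)"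
  let ?d = "of_nat (rdeg t) :: 'k"
  have d: "?d \<noteq> 0" using rdeg_pos[of t] by simp
  \<comment> \<open>Newton iteration for \<open>f\<^sup>t = h\<close> with the derivative frozen at \<open>f = 1\<close>;
    each step corrects one more degree.\<close>
  define F where "F = rec_nat pone (\<lambda>_ f S. f S + (h S - ?P f S) / ?d)"
  have F_Suc: "F (Suc n) S = F n S + (h S - ?P (F n) S) / ?d" for n S
    by (simp add: F_def)
  have F_None: "F n None = 1" for n
    by (induction n) (simp_all add: F_Suc tree_power_None assms, simp add: F_def pone_def pmonom_def)
  have F_root: "?P (F n) S = h S" if "pdeg S < n" for n S
    using that
  proof (induction n arbitrary: S)
    case (Suc n)
    \<comment> \<open>Below the degree of \<open>S\<close> the error is already 0, so the step
      changes nothing there. Hence the power changes at \<open>S\<close> by exactly the error it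
      had.\<close>
    have "F (Suc n) S' = F n S'" if "pdeg S' < pdeg S" for S'
      using Suc.IH[of S'] that Suc.prems by (simp add: F_Suc)
    then have "?P (F (Suc n)) S - ?P (F n) S = ?d * (F (Suc n) S - F n S)"
      using tree_power_diff F_None by blast
    also have "\<dots> = h S - ?P (F n) S"
      using d by (simp add: F_Suc)
    finally show ?case by simp
  qed simp
  \<comment> \<open>The coefficient at \<open>S\<close> is final from stage
    \<open>Suc (pdeg S)\<close> on, because the error at \<open>S\<close> vanishes from then
    on.\<close>
  define f where "f S = F (Suc (pdeg S)) S" for S
  have F_stable: "F n S = f S" if "pdeg S < n" for n S
    using that
  proof (induction n)
    case (Suc n)
    show ?case
    proof (cases "pdeg S < n")
      case True
      then show ?thesis using Suc.IH F_root[OF True] by (simp add: F_Suc)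
    next
      case False
      then have "pdeg S = n" using Suc.prems by simp
      then show ?thesis by (simp add: f_def)
    qed
  qed simp
  have f_None: "f None = 1" by (simp add: f_def F_None)
  have "?P f S = h S" for S
  proof -
    \<comment> \<open>This stage agrees with \<open>f\<close> in all degrees up to that of
      \<open>S\<close>, so both have the same power at \<open>S\<close>.\<close>
    let ?n = "Suc (pdeg S)"
    have "?P (F ?n) S - ?P f S = ?d * (F ?n S - f S)"
      by (rule tree_power_diff) (simp_all add: F_None f_None F_stable)
    then show ?thesis using F_root[of S ?n] F_stable[of S ?n] by simp
  qed
  then show ?thesis using f_None by blast
qed

theorem proposition6p1:
  fixes T :: ptree
  assumes "T \<noteq> None"
  shows "\<exists>!f :: 'k::field_char_0 pseries.
    tree_power f T = padd pone pX \<and> const_term f = 1"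
proof -
  from assms obtain t where T: "T = Some t" by auto
  have "padd pone pX None = (1 :: 'k)"
    by (simp add: padd_def pone_def pX_def pmonom_def)
  then show ?thesis
    unfolding T const_term_def
    using tree_root_exists[of "padd pone pX" t] tree_root_unique[of _ t] by metis
qed

end
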